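(* Let $\Gamma$ be a group, let $(H_i)_{i\in I}$ be a net in the space $\mathcal{N}(\Gamma)$ of normal subgroups of $\Gamma$ which converges to some $H\in\mathcal{N}(\Gamma)$. Let $A$ be an alphabet and let $\widetilde{\tau}\colon A^\Gamma\to A^\Gamma$ be a cellular automaton. Let $\tau_i\colon A^{\Gamma/H_i}\to A^{\Gamma/H_i}$ for $i\in I$, and $\tau\colon A^{\Gamma/H}\to A^{\Gamma/H}$, be the cellular automata induced by $\widetilde{\tau}$. Then the following hold. (i) If $\tau_i$ is pre-injective for every $i\in I$, then $\tau$ is also pre-injective. (ii) If $\tau_i$ is surjective for every $i\in I$, then $\tau$ is also surjective.
   Context: For a group $G$ and a discrete set $A$ (the alphabet), $A^G$ is the set of all maps $x\colon G\to A$ (configurations), with shift action $(gx)(h)=x(g^{-1}h)$. A cellular automaton $\tau\colon A^G\to A^G$ is a map for which there exist a finite subset $M\subset G$ (a memory set) and a map $\mu\colon A^M\to A$ (the local transition map) such that $\tau(x)(g)=\mu((g^{-1}x)|_M)$ for all $x\in A^G$, $g\in G$. Two configurations $x,y\in A^G$ are asymptotic if $x|_{G\setminus E}=y|_{G\setminus E}$ for some finite $E\subset G$. The cellular automaton $\tau$ is pre-injective if for all asymptotic $x,y\in A^G$, $\tau(x)=\tau(y)$ implies $x=y$. Topology on $\mathcal{N}(\Gamma)$: the set $\mathcal{N}(\Gamma)$ of normal subgroups of $\Gamma$ is viewed as a subspace of $\{0,1\}^\Gamma$ (product of discrete spaces) via indicator functions; a base of neighborhoods of $H$ is given by the sets $\{K\in\mathcal{N}(\Gamma)\colon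 K\cap E=H\cap E\}$, with $E\subset\Gamma$ finite. Thus $(H_i)_{i\in I}$ converges to $H$ iff for every finite $E\subset\Gamma$ there is $i_0\in I$ with $H_i\cap E=H\cap E$ for all $i\ge i_0$. Induced cellular automaton: for a normal subgroup $N\subset\Gamma$ with projection $\varphi\colon\Gamma\to\Gamma/N$, let $\operatorname{Fix}(N)=\{x\in A^\Gamma\colon hx=x\text{ for all }h\in N\}$ and let $\Phi\colon A^{\Gamma/N}\to\operatorname{Fix}(N)$ be the bijection $\Phi(x)=x\circ\varphi$. Then $\widetilde{\tau}$ maps $\operatorname{Fix}(N)$ into itself, and the cellular automaton induced by $\widetilde{\tau}$ on $A^{\Gamma/N}$ is $\Phi^{-1}\circ\widetilde{\tau}\circ\Phi$.
   Formalization: Part (ii) is proved for a finite alphabet A only; for infinite A it is false (e.g. Γ = Z, H_i = (i+1)Z converging to {0}, A = N×N with a suitable cellular automaton). Part (i) holds for an arbitrary alphabet. *)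

theory Defs
  imports "HOL-Analysis.Analysis" "HOL-Algebra.Coset"
begin

section \<open>Cellular automata over a group\<close>

text \<open>Configurations are extensional functions on the carrier of the group. The alphabet is an
  arbitrary set, possibly infinite.\<close>

definition configs :: "('g, 'b) monoid_scheme \<Rightarrow> 'a set \<Rightarrow> ('g \<Rightarrow> 'a) set" where
  "configs G A = carrier G \<rightarrow>\<^sub>E A"

definition shift :: "('g, 'b) monoid_scheme \<Rightarrow> 'g \<Rightarrow> ('g \<Rightarrow> 'a) \<Rightarrow> 'g \<Rightarrow> 'a" where
  "shift G g x = (\<lambda>h\<in>carrier G. x (inv\<^bsub>G\<^esub> g \<otimes>\<^bsub>G\<^esub> h))"

definition cellular_automaton ::
    "('g, 'b) monoid_scheme \<Rightarrow> 'a set \<Rightarrow> (('g \<Rightarrow> 'a) \<Rightarrow> 'g \<Rightarrow> 'a) \<Rightarrow> bool" where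
  "cellular_automaton G A \<tau> \<longleftrightarrow>
     \<tau> \<in> configs G A \<rightarrow> configs G A \<and>
     (\<exists>M \<mu>. finite M \<and> M \<subseteq> carrier G \<and> \<mu> \<in> (M \<rightarrow>\<^sub>E A) \<rightarrow> A \<and>
        (\<forall>x\<in>configs G A. \<forall>g\<in>carrier G. \<tau> x g = \<mu> (restrict (shift G (inv\<^bsub>G\<^esub> g) x) M)))"

definition asymptotic :: "('g, 'b) monoid_scheme \<Rightarrow> ('g \<Rightarrow> 'a) \<Rightarrow> ('g \<Rightarrow> 'a) \<Rightarrow> bool" where
  "asymptotic G x y \<longleftrightarrow>
     (\<exists>E. finite E \<and> E \<subseteq> carrier G \<and> (\<forall>g\<in>carrier G - E. x g = y g))"

definition pre_injective ::
    "('g, 'b) monoid_scheme \<Rightarrow> 'a set \<Rightarrow> (('g \<Rightarrow> 'a) \<Rightarrow> 'g \<Rightarrow> 'a) \<Rightarrow> bool" where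
  "pre_injective G A \<tau> \<longleftrightarrow>
     (\<forall>x\<in>configs G A. \<forall>y\<in>configs G A. asymptotic G x y \<longrightarrow> \<tau> x = \<tau> y \<longrightarrow> x = y)"

definition surjective_ca ::
    "('g, 'b) monoid_scheme \<Rightarrow> 'a set \<Rightarrow> (('g \<Rightarrow> 'a) \<Rightarrow> 'g \<Rightarrow> 'a) \<Rightarrow> bool" where
  "surjective_ca G A \<tau> \<longleftrightarrow> \<tau> ` configs G A = configs G A"


section \<open>Induced cellular automata on quotients\<close>

definition fix_configs :: "('g, 'b) monoid_scheme \<Rightarrow> 'a set \<Rightarrow> 'g set \<Rightarrow> ('g \<Rightarrow> 'a) set" where
  "fix_configs G A N = {x \<in> configs G A. \<forall>h\<in>N. shift G h x = x}"

text \<open>The projection onto \<open>G Mod N\<close> is \<open>\<lambda>g. N #>\<^bsub>G\<^esub> g\<close>.\<close>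

definition lift_config ::
    "('g, 'b) monoid_scheme \<Rightarrow> 'g set \<Rightarrow> ('g set \<Rightarrow> 'a) \<Rightarrow> 'g \<Rightarrow> 'a" where
  "lift_config G N x = (\<lambda>g\<in>carrier G. x (N #>\<^bsub>G\<^esub> g))"

text \<open>The inverse below is meaningful by the lemmas \<open>bij_betw_lift_config\<close> and
  \<open>cellular_automaton_fix_configs\<close>.\<close>

definition induced_ca ::
    "('g, 'b) monoid_scheme \<Rightarrow> 'a set \<Rightarrow> 'g set \<Rightarrow> (('g \<Rightarrow> 'a) \<Rightarrow> 'g \<Rightarrow> 'a) \<Rightarrow>
      ('g set \<Rightarrow> 'a) \<Rightarrow> 'g set \<Rightarrow> 'a" where
  "induced_ca G A N \<tau> =
     (\<lambda>x. inv_into (configs (G Mod N) A) (lift_config G N) (\<tau> (lift_config G N x)))"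

lemma bij_betw_lift_config:
  fixes G :: "('g, 'b) monoid_scheme"
  assumes "N \<lhd> G"
  shows "bij_betw (lift_config G N) (configs (G Mod N) A) (fix_configs G A N)"
proof -
  interpret normal N G by fact
  have NG: "N \<subseteq> carrier G" by (rule subset)
  have car: "carrier (G Mod N) = (\<lambda>g. N #>\<^bsub>G\<^esub> g) ` carrier G"
    by (auto simp: FactGroup_def RCOSETS_def)
  have inj: "inj_on (lift_config G N) (configs (G Mod N) A)"
  proof (rule inj_onI)
    fix x y assume x: "x \<in> configs (G Mod N) A" and y: "y \<in> configs (G Mod N) A"
      and e: "lift_config G N x = lift_config G N y"
    have "x c = y c" if c: "c \<in> carrier (G Mod N)" for c
    proof -
      obtain g where g: "g \<in> carrier G" "c = N #>\<^bsub>G\<^esub> g"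
        using c unfolding car by blast
      then show ?thesis using fun_cong[OF e, of g] g by (simp add: lift_config_def)
    qed
    with x y show "x = y" unfolding configs_def by (rule PiE_ext)
  qed
  have sub: "lift_config G N x \<in> fix_configs G A N" if x: "x \<in> configs (G Mod N) A" for x
  proof -
    have "shift G h (lift_config G N x) = lift_config G N x" if h: "h \<in> N" for h
    proof
      fix k
      show "shift G h (lift_config G N x) k = lift_config G N x k"
      proof (cases "k \<in> carrier G")
        case True
        have "N #>\<^bsub>G\<^esub> (inv\<^bsub>G\<^esub> h \<otimes>\<^bsub>G\<^esub> k) = N #>\<^bsub>G\<^esub> k"
        proof -
          have "inv\<^bsub>G\<^esub> h \<in> N" using h by simp
          then have "N #>\<^bsub>G\<^esub> inv\<^bsub>G\<^esub> h = N" using NG by (intro coset_join2 is_subgroup) auto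
          then show ?thesis using coset_mult_assoc[of N "inv\<^bsub>G\<^esub> h" k] h True NG by auto
        qed
        then show ?thesis using True h NG by (auto simp: shift_def lift_config_def)
      qed (simp add: shift_def lift_config_def)
    qed
    moreover have "lift_config G N x \<in> configs G A"
      using x unfolding configs_def lift_config_def car by (auto intro!: PiE_I)
    ultimately show ?thesis by (simp add: fix_configs_def)
  qed
  have "\<exists>x\<in>configs (G Mod N) A. lift_config G N x = y" if y: "y \<in> fix_configs G A N" for y
  proof -
    have yc: "y \<in> carrier G \<rightarrow>\<^sub>E A" using y by (simp add: fix_configs_def configs_def)
    have const: "y (h \<otimes>\<^bsub>G\<^esub> k) = y k" if h: "h \<in> N" and k: "k \<in> carrier G" for h k
    proof -
      have hG: "h \<in> carrier G" using h NG by auto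
      have "shift G (inv\<^bsub>G\<^esub> h) y = y" using y h by (simp add: fix_configs_def)
      from fun_cong[OF this, of k] show ?thesis using k hG by (simp add: shift_def)
    qed
    define x where "x = (\<lambda>c\<in>carrier (G Mod N). y (SOME g. g \<in> c))"
    have some: "y (SOME g. g \<in> N #>\<^bsub>G\<^esub> k) = y k" if k: "k \<in> carrier G" for k
    proof -
      have "(SOME g. g \<in> N #>\<^bsub>G\<^esub> k) \<in> N #>\<^bsub>G\<^esub> k"
        using rcos_self[OF k is_subgroup] by (rule someI)
      then obtain h where "h \<in> N" "(SOME g. g \<in> N #>\<^bsub>G\<^esub> k) = h \<otimes>\<^bsub>G\<^esub> k"
        unfolding r_coset_def by blast
      with const[OF _ k] show ?thesis by metis
    qed
    have "x \<in> configs (G Mod N) A"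
      unfolding configs_def x_def
    proof (rule restrict_PiE_iff[THEN iffD2], rule ballI)
      fix c assume "c \<in> carrier (G Mod N)"
      then obtain k where k: "k \<in> carrier G" "c = N #>\<^bsub>G\<^esub> k" unfolding car by blast
      show "y (SOME g. g \<in> c) \<in> A" unfolding k(2) some[OF k(1)] by (rule PiE_mem[OF yc k(1)])
    qed
    moreover have "lift_config G N x = y"
    proof
      fix k show "lift_config G N x k = y k"
      proof (cases "k \<in> carrier G")
        case True
        then have "N #>\<^bsub>G\<^esub> k \<in> carrier (G Mod N)" unfolding car by blast
        then have "x (N #>\<^bsub>G\<^esub> k) = y k" unfolding x_def restrict_apply using some[OF True] by argo
        then show ?thesis unfolding lift_config_def restrict_apply using True by argo
      next
        case False
        then show ?thesis using PiE_arb[OF yc False] by (simp add: lift_config_def)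
      qed
    qed
    ultimately show ?thesis by blast
  qed
  with inj sub show ?thesis unfolding bij_betw_def by blast
qed

lemma cellular_automaton_fix_configs:
  fixes G :: "('g, 'b) monoid_scheme"
  assumes "N \<lhd> G" and "cellular_automaton G A \<tau>" and x: "x \<in> fix_configs G A N"
  shows "\<tau> x \<in> fix_configs G A N"
proof -
  interpret normal N G by fact
  obtain M \<mu> where \<tau>: "\<tau> \<in> configs G A \<rightarrow> configs G A"
    and \<mu>: "\<And>x g. x \<in> configs G A \<Longrightarrow> g \<in> carrier G \<Longrightarrow>
                \<tau> x g = \<mu> (restrict (shift G (inv\<^bsub>G\<^esub> g) x) M)"
    using assms(2) unfolding cellular_automaton_def by blast
  have xc: "x \<in> configs G A" and xf: "\<And>h. h \<in> N \<Longrightarrow> shift G h x = x"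
    using x by (auto simp: fix_configs_def)
  have t: "\<tau> x \<in> configs G A" using \<tau> xc by blast
  have "shift G h (\<tau> x) = \<tau> x" if h: "h \<in> N" for h
  proof
    fix k
    have hG: "h \<in> carrier G" using h subset by auto
    show "shift G h (\<tau> x) k = \<tau> x k"
    proof (cases "k \<in> carrier G")
      case True
      have eq: "shift G (inv\<^bsub>G\<^esub> (inv\<^bsub>G\<^esub> h \<otimes>\<^bsub>G\<^esub> k)) x = shift G (inv\<^bsub>G\<^esub> k) x"
      proof
        fix l
        show "shift G (inv\<^bsub>G\<^esub> (inv\<^bsub>G\<^esub> h \<otimes>\<^bsub>G\<^esub> k)) x l = shift G (inv\<^bsub>G\<^esub> k) x l"
          using fun_cong[OF xf[OF h], of "k \<otimes>\<^bsub>G\<^esub> l"] True hG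
          by (cases "l \<in> carrier G") (auto simp: shift_def m_assoc inv_mult_group)
      qed
      have "shift G h (\<tau> x) k = \<tau> x (inv\<^bsub>G\<^esub> h \<otimes>\<^bsub>G\<^esub> k)" using True by (simp add: shift_def)
      also have "\<dots> = \<tau> x k"
        using \<mu>[OF xc, of "inv\<^bsub>G\<^esub> h \<otimes>\<^bsub>G\<^esub> k"] \<mu>[OF xc, of k] eq True hG by simp
      finally show ?thesis .
    next
      case False
      then show ?thesis using t by (auto simp: shift_def configs_def PiE_def extensional_def)
    qed
  qed
  then show ?thesis using t by (simp add: fix_configs_def)
qed


section \<open>Nets in the space of normal subgroups\<close>

text \<open>The topology on the normal subgroups induced from the product of the discrete two-point
  spaces (with \<open>bool\<close> for \<open>{0,1}\<close>) along the indicator function.\<close>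

definition normal_subgroup_topology :: "('g, 'b) monoid_scheme \<Rightarrow> 'g set topology" where
  "normal_subgroup_topology G =
     pullback_topology {N. N \<lhd> G} (\<lambda>N. \<lambda>g\<in>carrier G. g \<in> N)
       (product_topology (\<lambda>_. discrete_topology (UNIV :: bool set)) (carrier G))"

definition directed_set :: "'i set \<Rightarrow> ('i \<Rightarrow> 'i \<Rightarrow> bool) \<Rightarrow> bool" where
  "directed_set I r \<longleftrightarrow>
     I \<noteq> {} \<and> reflp_on I r \<and> transp_on I r \<and> (\<forall>i\<in>I. \<forall>j\<in>I. \<exists>k\<in>I. r i k \<and> r j k)"

definition net_filter :: "'i set \<Rightarrow> ('i \<Rightarrow> 'i \<Rightarrow> bool) \<Rightarrow> 'i filter" where
  "net_filter I r = (INF i\<in>I. principal {j \<in> I. r i j})"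

lemma eventually_net_filter:
  assumes "directed_set I r"
  shows "eventually P (net_filter I r) \<longleftrightarrow> (\<exists>i0\<in>I. \<forall>i\<in>I. r i0 i \<longrightarrow> P i)"
proof -
  have "\<exists>k\<in>I. principal {l \<in> I. r k l} \<le> inf (principal {l \<in> I. r i l}) (principal {l \<in> I. r j l})"
    if ij: "i \<in> I" "j \<in> I" for i j
  proof -
    obtain k where k: "k \<in> I" "r i k" "r j k"
      using assms ij unfolding directed_set_def by blast
    have tr: "transp_on I r" using assms by (simp add: directed_set_def)
    have "{l \<in> I. r k l} \<subseteq> {l \<in> I. r i l} \<inter> {l \<in> I. r j l}"
      using k ij transp_onD[OF tr] by blast
    with k(1) show ?thesis by (auto simp: inf_principal)
  qed
  then have "eventually P (net_filter I r) \<longleftrightarrow> (\<exists>i\<in>I. eventually P (principal {j \<in> I. r i j}))"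
    unfolding net_filter_def using assms
    by (intro eventually_INF_base) (auto simp: directed_set_def)
  then show ?thesis by (auto simp: eventually_principal)
qed

lemma limitin_normal_subgroup_topology:
  fixes G :: "('g, 'b) monoid_scheme" and I :: "'i set"
  assumes dir: "directed_set I r" and K: "\<And>i. i \<in> I \<Longrightarrow> K i \<lhd> G" and H: "H \<lhd> G"
  shows "limitin (normal_subgroup_topology G) K H (net_filter I r) \<longleftrightarrow>
    (\<forall>E. finite E \<and> E \<subseteq> carrier G \<longrightarrow>
       (\<exists>i0\<in>I. \<forall>i\<in>I. r i0 i \<longrightarrow> K i \<inter> E = H \<inter> E))"
proof -
  let ?P = "product_topology (\<lambda>_. discrete_topology (UNIV :: bool set)) (carrier G)"
  let ?\<chi> = "\<lambda>N. \<lambda>g\<in>carrier G. g \<in> N"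
  let ?F = "net_filter I r"
  have inI: "\<forall>\<^sub>F i in ?F. i \<in> I"
    using dir by (subst eventually_net_filter) (auto simp: directed_set_def)
  then have normal: "\<forall>\<^sub>F i in ?F. K i \<lhd> G" by (rule eventually_mono) (rule K)
  have "limitin (normal_subgroup_topology G) K H ?F \<longleftrightarrow> limitin ?P (\<lambda>i. ?\<chi> (K i)) (?\<chi> H) ?F"
    (is "?L \<longleftrightarrow> ?R")
  proof
    assume L: ?L
    show ?R unfolding limitin_def
    proof (intro conjI allI impI)
      show "?\<chi> H \<in> topspace ?P" by simp
      fix U assume U: "openin ?P U \<and> ?\<chi> H \<in> U"
      then have "openin (normal_subgroup_topology G) (?\<chi> -` U \<inter> {N. N \<lhd> G})"
        unfolding normal_subgroup_topology_def openin_pullback_topology by blast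
      then have "\<forall>\<^sub>F i in ?F. K i \<in> ?\<chi> -` U \<inter> {N. N \<lhd> G}"
        using L U H unfolding limitin_def by blast
      then show "\<forall>\<^sub>F i in ?F. ?\<chi> (K i) \<in> U" by (rule eventually_mono) auto
    qed
  next
    assume R: ?R
    show ?L unfolding limitin_def
    proof (intro conjI allI impI)
      show "H \<in> topspace (normal_subgroup_topology G)"
        using H by (simp add: normal_subgroup_topology_def topspace_pullback_topology)
      fix U assume U: "openin (normal_subgroup_topology G) U \<and> H \<in> U"
      then obtain V where V: "openin ?P V" "U = ?\<chi> -` V \<inter> {N. N \<lhd> G}"
        unfolding normal_subgroup_topology_def openin_pullback_topology by blast
      with U R have "\<forall>\<^sub>F i in ?F. ?\<chi> (K i) \<in> V" unfolding limitin_def by auto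
      with normal show "\<forall>\<^sub>F i in ?F. K i \<in> U" by eventually_elim (use V in auto)
    qed
  qed
  also have "\<dots> \<longleftrightarrow> (\<forall>g\<in>carrier G. \<forall>\<^sub>F i in ?F. (g \<in> K i) = (g \<in> H))"
  proof -
    have disc: "limitin (discrete_topology UNIV) f b ?F \<longleftrightarrow> (\<forall>\<^sub>F i in ?F. f i = b)"
      for f :: "'i \<Rightarrow> bool" and b
    proof
      assume "limitin (discrete_topology UNIV) f b ?F"
      then have "\<forall>\<^sub>F i in ?F. f i \<in> {b}" unfolding limitin_def openin_discrete_topology by blast
      then show "\<forall>\<^sub>F i in ?F. f i = b" by simp
    next
      assume "\<forall>\<^sub>F i in ?F. f i = b"
      then show "limitin (discrete_topology UNIV) f b ?F"
        unfolding limitin_def by (auto elim: eventually_mono)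
    qed
    show ?thesis by (simp add: limitin_componentwise disc)
  qed
  also have "\<dots> \<longleftrightarrow> (\<forall>E. finite E \<and> E \<subseteq> carrier G \<longrightarrow> (\<forall>\<^sub>F i in ?F. K i \<inter> E = H \<inter> E))"
  proof (intro iffI allI ballI impI)
    fix E assume a: "\<forall>g\<in>carrier G. \<forall>\<^sub>F i in ?F. (g \<in> K i) = (g \<in> H)"
      and E: "finite E \<and> E \<subseteq> carrier G"
    then have "\<forall>\<^sub>F i in ?F. \<forall>g\<in>E. (g \<in> K i) = (g \<in> H)" by (intro eventually_ball_finite) auto
    then show "\<forall>\<^sub>F i in ?F. K i \<inter> E = H \<inter> E" by (rule eventually_mono) auto
  next
    fix g assume a: "\<forall>E. finite E \<and> E \<subseteq> carrier G \<longrightarrow> (\<forall>\<^sub>F i in ?F. K i \<inter> E = H \<inter> E)"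
      and "g \<in> carrier G"
    then have "\<forall>\<^sub>F i in ?F. K i \<inter> {g} = H \<inter> {g}" by simp
    then show "\<forall>\<^sub>F i in ?F. (g \<in> K i) = (g \<in> H)" by (rule eventually_mono) auto
  qed
  finally show ?thesis by (simp add: eventually_net_filter[OF dir])
qed

end

theory Submission
  imports Defs
begin

text \<open>Configurations on \<open>\<Gamma> Mod N\<close> are the configurations on \<open>\<Gamma>\<close> that are constant on the cosets
  of \<open>N\<close>, and for \<open>i\<close> large \<open>Hi i\<close> and \<open>H\<close> induce the same coset partition on any given finite
  set \<open>F\<close>, so that any \<open>H\<close>-periodic pattern on \<open>F\<close> extends to an \<open>Hi i\<close>-periodic configuration.
  For pre-injectivity, a pair of \<open>H\<close>-periodic configurations that differ over a finite set \<open>E\<close> of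
  cosets but have the same image is thus copied, on the neighbourhood \<open>E M\<inverse> M\<close> of \<open>E\<close>
  (\<open>M\<close> the memory set), to such a pair for \<open>Hi i\<close>. For surjectivity, being an \<open>H\<close>-periodic preimage
  of \<open>y\<close> is a conjunction of conditions that involve finitely many coordinates each, any finitely
  many of which are met by an \<open>Hi i\<close>-periodic preimage of an \<open>Hi i\<close>-periodic copy of \<open>y\<close>;
  compactness of \<open>A\<^sup>\<Gamma>\<close> concludes.\<close>

section \<open>Cosets, periodic configurations and locality\<close>

lemma (in group) rcos_eq_iff:
  assumes "subgroup N G" "g \<in> carrier G" "h \<in> carrier G"
  shows "N #> g = N #> h \<longleftrightarrow> g \<otimes> inv h \<in> N"
proof
  assume "N #> g = N #> h"
  then have "g \<in> N #> h" using rcos_self[OF assms(2,1)] by simp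
  then obtain n where "n \<in> N" "g = n \<otimes> h" unfolding r_coset_def by blast
  then show "g \<otimes> inv h \<in> N"
    using assms subgroup.mem_carrier[OF assms(1)] by (simp add: m_assoc)
next
  assume *: "g \<otimes> inv h \<in> N"
  have "g = (g \<otimes> inv h) \<otimes> h" using assms by (simp add: m_assoc)
  then have "g \<in> N #> h" unfolding r_coset_def using * by blast
  then show "N #> g = N #> h" using repr_independence assms by blast
qed

lemma (in group) rcos_mult_cong:
  assumes "subgroup N G" "g \<in> carrier G" "h \<in> carrier G" "k \<in> carrier G" "N #> g = N #> h"
  shows "N #> (g \<otimes> k) = N #> (h \<otimes> k)"
  using assms coset_mult_assoc subgroup.subset by metis

lemma carrier_FactGroup_image: "carrier (G Mod N) = (\<lambda>g. N #>\<^bsub>G\<^esub> g) ` carrier G"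
  by (auto simp: FactGroup_def RCOSETS_def)

text \<open>Left translation by elements of \<open>N\<close> moves a point within its coset. In this
  form periodicity is a family of conditions on two coordinates each, and \<open>N\<close> enters
  only through equalities of cosets, which convergence controls on finite sets.\<close>

lemma fix_configs_iff:
  fixes G :: "('g, 'b) monoid_scheme"
  assumes "N \<lhd> G"
  shows "x \<in> fix_configs G A N \<longleftrightarrow> x \<in> configs G A \<and>
    (\<forall>g\<in>carrier G. \<forall>h\<in>carrier G. N #>\<^bsub>G\<^esub> g = N #>\<^bsub>G\<^esub> h \<longrightarrow> x g = x h)"
proof -
  interpret normal N G by fact
  show ?thesis
  proof (intro iffI conjI ballI impI)
    fix g h
    assume x: "x \<in> fix_configs G A N" and gh: "g \<in> carrier G" "h \<in> carrier G"
      "N #>\<^bsub>G\<^esub> g = N #>\<^bsub>G\<^esub> h"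
    \<comment> \<open>A fixed configuration is a lift from the quotient, so its values factor
      through the projection.\<close>
    have "x \<in> lift_config G N ` configs (G Mod N) A"
      using x bij_betw_lift_config[OF assms, of A] by (simp add: bij_betw_def)
    then show "x g = x h" using gh by (auto simp: lift_config_def)
  next
    assume x: "x \<in> configs G A \<and>
      (\<forall>g\<in>carrier G. \<forall>h\<in>carrier G. N #>\<^bsub>G\<^esub> g = N #>\<^bsub>G\<^esub> h \<longrightarrow> x g = x h)"
    have "shift G n x = x" if n: "n \<in> N" for n
    proof
      fix k show "shift G n x k = x k"
      proof (cases "k \<in> carrier G")
        case True
        have nG: "n \<in> carrier G" using n by (rule mem_carrier)
        have "N #>\<^bsub>G\<^esub> (inv\<^bsub>G\<^esub> n \<otimes>\<^bsub>G\<^esub> k) = N #>\<^bsub>G\<^esub> k"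
          using n nG True by (subst rcos_eq_iff[OF is_subgroup]) (simp_all add: m_assoc)
        then have "x (inv\<^bsub>G\<^esub> n \<otimes>\<^bsub>G\<^esub> k) = x k" using x True nG by blast
        then show ?thesis using True by (simp add: shift_def)
      next
        case False
        then show ?thesis using PiE_arb[OF conjunct1[OF x, unfolded configs_def]]
          by (simp add: shift_def)
      qed
    qed
    then show "x \<in> fix_configs G A N" using conjunct1[OF x] by (simp add: fix_configs_def)
  qed (simp add: fix_configs_def)
qed

lemma fix_configs_rcos:
  assumes "N \<lhd> G" "x \<in> fix_configs G A N" "g \<in> carrier G" "h \<in> carrier G"
    "N #>\<^bsub>G\<^esub> g = N #>\<^bsub>G\<^esub> h"
  shows "x g = x h"
  using assms(2-) unfolding fix_configs_iff[OF assms(1)] by blast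

text \<open>The local map receives the same argument at both points. Allowing two base points
  \<open>g\<close> and \<open>h\<close> combines locality with equivariance, so that a window may be
  moved to another representative of its coset.\<close>

lemma cellular_automaton_local:
  fixes G :: "('g, 'b) monoid_scheme"
  assumes "group G" "cellular_automaton G A \<tau>"
  obtains M where "finite M" "M \<subseteq> carrier G"
    "\<And>x y g h. x \<in> configs G A \<Longrightarrow> y \<in> configs G A \<Longrightarrow> g \<in> carrier G \<Longrightarrow> h \<in> carrier G \<Longrightarrow>
      (\<And>m. m \<in> M \<Longrightarrow> x (g \<otimes>\<^bsub>G\<^esub> m) = y (h \<otimes>\<^bsub>G\<^esub> m)) \<Longrightarrow> \<tau> x g = \<tau> y h"
proof -
  interpret group G by fact
  obtain M \<mu> where M: "finite M" "M \<subseteq> carrier G"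
    and \<mu>: "\<And>x g. x \<in> configs G A \<Longrightarrow> g \<in> carrier G \<Longrightarrow>
      \<tau> x g = \<mu> (restrict (shift G (inv\<^bsub>G\<^esub> g) x) M)"
    using assms(2) unfolding cellular_automaton_def by blast
  show thesis
  proof (rule that[OF M])
    fix x y g h
    assume xy: "x \<in> configs G A" "y \<in> configs G A" "g \<in> carrier G" "h \<in> carrier G"
      and e: "\<And>m. m \<in> M \<Longrightarrow> x (g \<otimes>\<^bsub>G\<^esub> m) = y (h \<otimes>\<^bsub>G\<^esub> m)"
    have "restrict (shift G (inv\<^bsub>G\<^esub> g) x) M = restrict (shift G (inv\<^bsub>G\<^esub> h) y) M"
      using M(2) xy e by (intro restrict_ext) (auto simp: shift_def)
    then show "\<tau> x g = \<tau> y h" using \<mu> xy by simp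
  qed
qed

section \<open>Induced automata described upstairs on the full group\<close>

text \<open>Since \<tau> preserves the periodic configurations, which are the lifts,
  \<open>inv_into\<close> is applied to an actual lift. Hence \<open>lift_config\<close> conjugates
  the induced map to the restriction of \<tau>.\<close>

lemma induced_ca:
  assumes "N \<lhd> G" "cellular_automaton G A \<tau>" "x \<in> configs (G Mod N) A"
  shows induced_ca_in_configs: "induced_ca G A N \<tau> x \<in> configs (G Mod N) A"
    and lift_config_induced_ca:
      "lift_config G N (induced_ca G A N \<tau> x) = \<tau> (lift_config G N x)"
proof -
  have im: "lift_config G N ` configs (G Mod N) A = fix_configs G A N"
    using bij_betw_lift_config[OF assms(1), of A] by (simp add: bij_betw_def)
  then have "\<tau> (lift_config G N x) \<in> lift_config G N ` configs (G Mod N) A"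
    using cellular_automaton_fix_configs[OF assms(1,2)] assms(3) by blast
  then show "induced_ca G A N \<tau> x \<in> configs (G Mod N) A"
    and "lift_config G N (induced_ca G A N \<tau> x) = \<tau> (lift_config G N x)"
    unfolding induced_ca_def by (rule inv_into_into, rule f_inv_into_f)
qed

lemma asymptotic_FactGroup_iff:
  "asymptotic (G Mod N) x y \<longleftrightarrow>
    (\<exists>E. finite E \<and> E \<subseteq> carrier G \<and> (\<forall>g\<in>carrier G. (\<forall>e\<in>E. N #>\<^bsub>G\<^esub> g \<noteq> N #>\<^bsub>G\<^esub> e) \<longrightarrow>
      lift_config G N x g = lift_config G N y g))"
proof -
  let ?p = "\<lambda>g. N #>\<^bsub>G\<^esub> g"
  have "(\<forall>c\<in>?p ` carrier G - ?p ` E. x c = y c) \<longleftrightarrow>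
      (\<forall>g\<in>carrier G. (\<forall>e\<in>E. ?p g \<noteq> ?p e) \<longrightarrow> lift_config G N x g = lift_config G N y g)" for E
  proof -
    have "(\<forall>c\<in>?p ` carrier G - ?p ` E. x c = y c) \<longleftrightarrow>
        (\<forall>g\<in>carrier G. ?p g \<notin> ?p ` E \<longrightarrow> x (?p g) = y (?p g))" by blast
    also have "\<dots> \<longleftrightarrow> (\<forall>g\<in>carrier G. (\<forall>e\<in>E. ?p g \<noteq> ?p e) \<longrightarrow>
        lift_config G N x g = lift_config G N y g)"
      by (intro ball_cong) (simp_all add: lift_config_def image_iff)
    finally show ?thesis .
  qed
  then show ?thesis
    unfolding asymptotic_def carrier_FactGroup_image
    \<comment> \<open>A finite set of cosets is exchanged for a finite set \<open>E\<close> of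
      representatives.\<close>
    using ex_finite_subset_image[where f = ?p and A = "carrier G"
        and P = "\<lambda>E'. \<forall>c\<in>?p ` carrier G - E'. x c = y c"] by (simp only: conj_assoc)
qed

text \<open>Transport along the bijection \<open>lift_config\<close> makes different
  \<open>N\<close> comparable inside one configuration space. Asymptotic pairs become periodic pairs
  that agree off the union of finitely many cosets, a union that may be infinite.\<close>

lemma pre_injective_induced_ca_iff:
  assumes N: "N \<lhd> G" and ca: "cellular_automaton G A \<tau>"
  shows "pre_injective (G Mod N) A (induced_ca G A N \<tau>) \<longleftrightarrow>
    (\<forall>x\<in>fix_configs G A N. \<forall>y\<in>fix_configs G A N. \<forall>E. finite E \<longrightarrow> E \<subseteq> carrier G \<longrightarrow>
      (\<forall>g\<in>carrier G. (\<forall>e\<in>E. N #>\<^bsub>G\<^esub> g \<noteq> N #>\<^bsub>G\<^esub> e) \<longrightarrow> x g = y g) \<longrightarrow>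
      \<tau> x = \<tau> y \<longrightarrow> x = y)"
proof -
  have inj: "inj_on (lift_config G N) (configs (G Mod N) A)"
    and im: "fix_configs G A N = lift_config G N ` configs (G Mod N) A"
    using bij_betw_lift_config[OF N, of A] by (simp_all add: bij_betw_def)
  have "induced_ca G A N \<tau> x = induced_ca G A N \<tau> y \<longleftrightarrow>
      \<tau> (lift_config G N x) = \<tau> (lift_config G N y)"
    if "x \<in> configs (G Mod N) A" "y \<in> configs (G Mod N) A" for x y
    using inj_on_eq_iff[OF inj induced_ca_in_configs[OF N ca that(1)]
        induced_ca_in_configs[OF N ca that(2)]]
      lift_config_induced_ca[OF N ca that(1)] lift_config_induced_ca[OF N ca that(2)] by simp
  then show ?thesis
    unfolding pre_injective_def asymptotic_FactGroup_iff im ball_simps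
    using inj_on_eq_iff[OF inj] by (simp cong: ball_cong) blast
qed

text \<open>Surjectivity can be tested after the injective lift; one inclusion is enough because
  \<tau> maps periodic configurations to periodic ones.\<close>

lemma surjective_induced_ca_iff:
  assumes N: "N \<lhd> G" and ca: "cellular_automaton G A \<tau>"
  shows "surjective_ca (G Mod N) A (induced_ca G A N \<tau>) \<longleftrightarrow>
    fix_configs G A N \<subseteq> \<tau> ` fix_configs G A N"
proof -
  let ?C = "configs (G Mod N) A"
  have inj: "inj_on (lift_config G N) ?C" and im: "fix_configs G A N = lift_config G N ` ?C"
    using bij_betw_lift_config[OF N, of A] by (simp_all add: bij_betw_def)
  have sub: "induced_ca G A N \<tau> ` ?C \<subseteq> ?C" using induced_ca_in_configs[OF N ca] by blast
  have "surjective_ca (G Mod N) A (induced_ca G A N \<tau>) \<longleftrightarrow>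
      lift_config G N ` ?C = lift_config G N ` induced_ca G A N \<tau> ` ?C"
    unfolding surjective_ca_def using inj_on_image_eq_iff[OF inj _ sub] by auto
  also have "lift_config G N ` induced_ca G A N \<tau> ` ?C = \<tau> ` fix_configs G A N"
    unfolding im image_image using lift_config_induced_ca[OF N ca] by simp
  finally show ?thesis
    using cellular_automaton_fix_configs[OF N ca] unfolding im by blast
qed

section \<open>Copying patterns between normal subgroups\<close>

text \<open>By \<open>per\<close> the pattern descends to the cosets that meet \<open>F\<close>. The
  value \<open>a\<close> fills all other cosets, so two extensions built with the same
  \<open>a\<close> agree there.\<close>

lemma fix_configs_extend:
  fixes G :: "('g, 'b) monoid_scheme"
  assumes N: "N \<lhd> G" and a: "a \<in> A" and F: "F \<subseteq> carrier G" and x: "x \<in> F \<rightarrow> A"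
    and per: "\<And>f f'. f \<in> F \<Longrightarrow> f' \<in> F \<Longrightarrow> N #>\<^bsub>G\<^esub> f = N #>\<^bsub>G\<^esub> f' \<Longrightarrow> x f = x f'"
  obtains z where "z \<in> fix_configs G A N"
    "\<And>g f. g \<in> carrier G \<Longrightarrow> f \<in> F \<Longrightarrow> N #>\<^bsub>G\<^esub> g = N #>\<^bsub>G\<^esub> f \<Longrightarrow> z g = x f"
    "\<And>g. g \<in> carrier G \<Longrightarrow> \<forall>f\<in>F. N #>\<^bsub>G\<^esub> g \<noteq> N #>\<^bsub>G\<^esub> f \<Longrightarrow> z g = a"
proof
  define z where "z = (\<lambda>g\<in>carrier G. if \<exists>f\<in>F. N #>\<^bsub>G\<^esub> g = N #>\<^bsub>G\<^esub> f
    then x (SOME f. f \<in> F \<and> N #>\<^bsub>G\<^esub> g = N #>\<^bsub>G\<^esub> f) else a)"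
  show z1: "z g = x f" if "g \<in> carrier G" "f \<in> F" "N #>\<^bsub>G\<^esub> g = N #>\<^bsub>G\<^esub> f" for g f
  proof -
    have "(SOME f. f \<in> F \<and> N #>\<^bsub>G\<^esub> g = N #>\<^bsub>G\<^esub> f) \<in> F \<and>
        N #>\<^bsub>G\<^esub> g = N #>\<^bsub>G\<^esub> (SOME f. f \<in> F \<and> N #>\<^bsub>G\<^esub> g = N #>\<^bsub>G\<^esub> f)"
      by (rule someI[of _ f]) (use that in blast)
    then have "x (SOME f. f \<in> F \<and> N #>\<^bsub>G\<^esub> g = N #>\<^bsub>G\<^esub> f) = x f"
      using that by (intro per) auto
    then show ?thesis unfolding z_def using that by auto
  qed
  show z2: "z g = a" if "g \<in> carrier G" "\<forall>f\<in>F. N #>\<^bsub>G\<^esub> g \<noteq> N #>\<^bsub>G\<^esub> f" for g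
    using that by (simp add: z_def)
  have "z g \<in> A" if "g \<in> carrier G" for g
    using z1[OF that] z2[OF that] x a by (cases "\<exists>f\<in>F. N #>\<^bsub>G\<^esub> g = N #>\<^bsub>G\<^esub> f") auto
  then have "z \<in> configs G A"
    unfolding configs_def by (intro PiE_I) (auto simp: z_def)
  moreover have "z g = z h" if "g \<in> carrier G" "h \<in> carrier G" "N #>\<^bsub>G\<^esub> g = N #>\<^bsub>G\<^esub> h" for g h
    using that by (simp add: z_def)
  ultimately show "z \<in> fix_configs G A N" unfolding fix_configs_iff[OF N] by blast
qed

text \<open>Equality of the cosets of \<open>f\<close> and \<open>f'\<close> is membership of the
  quotient of \<open>f\<close> by \<open>f'\<close>, and for \<open>f\<close>, \<open>f'\<close> in
  \<open>F\<close> these quotients form a finite set.\<close>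

lemma limitin_same_cosets:
  fixes G :: "('g, 'b) monoid_scheme" and I :: "'i set"
  assumes G: "group G" and dir: "directed_set I r" and K: "\<And>i. i \<in> I \<Longrightarrow> K i \<lhd> G"
    and H: "H \<lhd> G" and lim: "limitin (normal_subgroup_topology G) K H (net_filter I r)"
    and F: "finite F" "F \<subseteq> carrier G"
  obtains i where "i \<in> I"
    "\<And>f f'. f \<in> F \<Longrightarrow> f' \<in> F \<Longrightarrow> K i #>\<^bsub>G\<^esub> f = K i #>\<^bsub>G\<^esub> f' \<longleftrightarrow> H #>\<^bsub>G\<^esub> f = H #>\<^bsub>G\<^esub> f'"
proof -
  interpret group G by fact
  define E where "E = (\<lambda>(f, f'). f \<otimes>\<^bsub>G\<^esub> inv\<^bsub>G\<^esub> f') ` (F \<times> F)"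
  have "finite E" "E \<subseteq> carrier G" using F by (auto simp: E_def subset_iff)
  then obtain i where i: "i \<in> I" "\<forall>j\<in>I. r i j \<longrightarrow> K j \<inter> E = H \<inter> E"
    using limitin_normal_subgroup_topology[of I r K G H] dir K H lim by blast
  \<comment> \<open>The agreement holds at every index beyond \<open>i\<close>; by reflexivity it
    holds at \<open>i\<close> itself.\<close>
  have "r i i" using dir i(1) by (auto simp: directed_set_def reflp_on_def)
  then have eq: "K i \<inter> E = H \<inter> E" using i by blast
  show thesis
  proof (rule that[OF i(1)])
    fix f f' assume f: "f \<in> F" "f' \<in> F"
    then have "f \<otimes>\<^bsub>G\<^esub> inv\<^bsub>G\<^esub> f' \<in> E"
      unfolding E_def by (intro image_eqI[of _ _ "(f, f')"]) auto
    then have "f \<otimes>\<^bsub>G\<^esub> inv\<^bsub>G\<^esub> f' \<in> K i \<longleftrightarrow> f \<otimes>\<^bsub>G\<^esub> inv\<^bsub>G\<^esub> f' \<in> H" using eq by blast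
    then show "K i #>\<^bsub>G\<^esub> f = K i #>\<^bsub>G\<^esub> f' \<longleftrightarrow> H #>\<^bsub>G\<^esub> f = H #>\<^bsub>G\<^esub> f'"
      using f F K[OF i(1)] H by (simp add: rcos_eq_iff normal_imp_subgroup subset_iff)
  qed
qed

section \<open>Compactness for finitary conditions\<close>

text \<open>With \<open>A\<close> finite and discrete the product is compact. A condition on
  finitely many coordinates defines a closed set, and \<open>fin\<close> supplies the finite
  intersection property.\<close>

lemma PiE_finitary_compactness:
  fixes P :: "'c \<Rightarrow> ('x \<Rightarrow> 'a) \<Rightarrow> bool"
  assumes A: "finite A"
    and loc: "\<And>c. c \<in> C \<Longrightarrow> \<exists>S. finite S \<and> S \<subseteq> X \<and>
      (\<forall>x\<in>X \<rightarrow>\<^sub>E A. \<forall>y\<in>X \<rightarrow>\<^sub>E A. (\<forall>s\<in>S. x s = y s) \<longrightarrow> P c x \<longrightarrow> P c y)"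
    and fin: "\<And>D. finite D \<Longrightarrow> D \<subseteq> C \<Longrightarrow> \<exists>x\<in>X \<rightarrow>\<^sub>E A. \<forall>c\<in>D. P c x"
  obtains x where "x \<in> X \<rightarrow>\<^sub>E A" "\<And>c. c \<in> C \<Longrightarrow> P c x"
proof -
  let ?T = "product_topology (\<lambda>_. discrete_topology A) X"
  have compact: "compact_space ?T"
    using A by (simp add: compact_space_product_topology compact_space_discrete_topology)
  have closed: "closedin ?T {x \<in> X \<rightarrow>\<^sub>E A. P c x}" if c: "c \<in> C" for c
  proof -
    obtain S where S: "finite S" "S \<subseteq> X"
      and PS: "\<forall>x\<in>X \<rightarrow>\<^sub>E A. \<forall>y\<in>X \<rightarrow>\<^sub>E A. (\<forall>s\<in>S. x s = y s) \<longrightarrow> P c x \<longrightarrow> P c y"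
      using loc[OF c] by (elim exE conjE)
    have "openin ?T {x \<in> X \<rightarrow>\<^sub>E A. \<not> P c x}"
    proof (subst openin_subopen, rule ballI)
      fix x assume x: "x \<in> {x \<in> X \<rightarrow>\<^sub>E A. \<not> P c x}"
      \<comment> \<open>The basic neighbourhood of \<open>x\<close> that freezes the coordinates in
        \<open>S\<close>: a point of it satisfying \<open>P c\<close> would force
        \<open>P c x\<close>.\<close>
      let ?U = "\<Pi>\<^sub>E s\<in>X. if s \<in> S then {x s} else A"
      have "openin ?T ?U"
        using x S by (subst openin_PiE_gen) (auto intro: finite_subset[OF _ S(1)])
      moreover have "x \<in> ?U" using x by (auto simp: PiE_iff)
      moreover have "?U \<subseteq> {x \<in> X \<rightarrow>\<^sub>E A. \<not> P c x}"
      proof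
        fix y assume y: "y \<in> ?U"
        then have "y s \<in> A" if "s \<in> X" for s
          using x PiE_mem[OF y that] PiE_mem[of x X "\<lambda>_. A" s] that by (auto split: if_splits)
        then have yA: "y \<in> X \<rightarrow>\<^sub>E A" using y by (auto simp: PiE_iff)
        moreover have "y s = x s" if "s \<in> S" for s
          using PiE_mem[OF y, of s] that S(2) by auto
        ultimately show "y \<in> {x \<in> X \<rightarrow>\<^sub>E A. \<not> P c x}" using PS x by fastforce
      qed
      ultimately show "\<exists>U. openin ?T U \<and> x \<in> U \<and> U \<subseteq> {x \<in> X \<rightarrow>\<^sub>E A. \<not> P c x}" by blast
    qed
    moreover have "(X \<rightarrow>\<^sub>E A) - {x \<in> X \<rightarrow>\<^sub>E A. P c x} = {x \<in> X \<rightarrow>\<^sub>E A. \<not> P c x}" by blast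
    ultimately show ?thesis by (auto simp: closedin_def)
  qed
  \<comment> \<open>Including the whole product keeps the intersection inside it even if
    \<open>C\<close> is empty.\<close>
  define \<U> where "\<U> = insert (X \<rightarrow>\<^sub>E A) ((\<lambda>c. {x \<in> X \<rightarrow>\<^sub>E A. P c x}) ` C)"
  have "closedin ?T (X \<rightarrow>\<^sub>E A)" using closedin_topspace[of ?T] by simp
  then have "\<forall>U\<in>\<U>. closedin ?T U" using closed by (simp add: \<U>_def)
  moreover have "\<Inter>\<F> \<noteq> {}" if "finite \<F>" "\<F> \<subseteq> \<U>" for \<F>
  proof -
    have "finite (\<F> - {X \<rightarrow>\<^sub>E A})"
      and "\<F> - {X \<rightarrow>\<^sub>E A} \<subseteq> (\<lambda>c. {x \<in> X \<rightarrow>\<^sub>E A. P c x}) ` C"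
      using that by (auto simp: \<U>_def)
    from finite_subset_image[OF this] obtain D where D: "D \<subseteq> C" "finite D"
      "\<F> - {X \<rightarrow>\<^sub>E A} = (\<lambda>c. {x \<in> X \<rightarrow>\<^sub>E A. P c x}) ` D" by (elim exE conjE)
    obtain x where "x \<in> X \<rightarrow>\<^sub>E A" "\<forall>c\<in>D. P c x" using fin[OF D(2,1)] by blast
    then have "x \<in> U" if "U \<in> insert (X \<rightarrow>\<^sub>E A) (\<F> - {X \<rightarrow>\<^sub>E A})" for U
      using that unfolding D(3) by auto
    then have "x \<in> \<Inter>\<F>" by auto
    then show ?thesis by auto
  qed
  ultimately have "\<Inter>\<U> \<noteq> {}"
    using compact[unfolded compact_space_fip, THEN spec, of \<U>] by simp
  then show thesis using that by (auto simp: \<U>_def)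
qed

section \<open>Passage to the limit\<close>

lemma pre_injective_induced_ca_limit:
  fixes G :: "('g, 'b) monoid_scheme" and I :: "'i set"
  assumes G: "group G" and dir: "directed_set I r" and K: "\<And>i. i \<in> I \<Longrightarrow> K i \<lhd> G"
    and H: "H \<lhd> G" and lim: "limitin (normal_subgroup_topology G) K H (net_filter I r)"
    and ca: "cellular_automaton G A \<tau>"
    and pre: "\<And>i. i \<in> I \<Longrightarrow> pre_injective (G Mod K i) A (induced_ca G A (K i) \<tau>)"
  shows "pre_injective (G Mod H) A (induced_ca G A H \<tau>)"
  unfolding pre_injective_induced_ca_iff[OF H ca]
proof (intro ballI allI impI)
  fix x y E
  assume x: "x \<in> fix_configs G A H" and y: "y \<in> fix_configs G A H"
    and E: "finite E" "E \<subseteq> carrier G"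
    and off: "\<forall>g\<in>carrier G. (\<forall>e\<in>E. H #>\<^bsub>G\<^esub> g \<noteq> H #>\<^bsub>G\<^esub> e) \<longrightarrow> x g = y g"
    and \<tau>xy: "\<tau> x = \<tau> y"
  interpret group G by fact
  have xc: "x \<in> configs G A" and yc: "y \<in> configs G A" using x y by (auto simp: fix_configs_def)
  have xA: "x g \<in> A" and yA: "y g \<in> A" if "g \<in> carrier G" for g
    using xc yc that by (auto simp: configs_def PiE_iff)
  obtain M where M: "finite M" "M \<subseteq> carrier G"
    and local: "\<And>x y g h. x \<in> configs G A \<Longrightarrow> y \<in> configs G A \<Longrightarrow> g \<in> carrier G \<Longrightarrow>
      h \<in> carrier G \<Longrightarrow> (\<And>m. m \<in> M \<Longrightarrow> x (g \<otimes>\<^bsub>G\<^esub> m) = y (h \<otimes>\<^bsub>G\<^esub> m)) \<Longrightarrow> \<tau> x g = \<tau> y h"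
    using cellular_automaton_local[OF G ca] by blast
  \<comment> \<open>If a window \<open>g M\<close> meets the coset of \<open>e\<close> at
    \<open>m\<close>, then \<open>g\<close> is equivalent to \<open>e\<close> times the inverse of
    \<open>m\<close>, and \<open>F\<close> contains the whole window at that point. Adding
    \<open>E\<close> separately matters when \<open>M\<close> is empty.\<close>
  define F where "F = E \<union> (\<lambda>(e, m, m'). e \<otimes>\<^bsub>G\<^esub> inv\<^bsub>G\<^esub> m \<otimes>\<^bsub>G\<^esub> m') ` (E \<times> M \<times> M)"
  have F: "finite F" "F \<subseteq> carrier G" using E M by (auto simp: F_def subset_iff)
  obtain i where i: "i \<in> I" and same: "\<And>f f'. f \<in> F \<Longrightarrow> f' \<in> F \<Longrightarrow>
      K i #>\<^bsub>G\<^esub> f = K i #>\<^bsub>G\<^esub> f' \<longleftrightarrow> H #>\<^bsub>G\<^esub> f = H #>\<^bsub>G\<^esub> f'"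
    using limitin_same_cosets[OF G dir K H lim F] by blast
  note sub = normal_imp_subgroup[OF K[OF i]]
  have Fx: "x \<in> F \<rightarrow> A" and Fy: "y \<in> F \<rightarrow> A" using xA yA F(2) by auto
  have per: "z f = z f'" if "z \<in> fix_configs G A H" "f \<in> F" "f' \<in> F"
      "K i #>\<^bsub>G\<^esub> f = K i #>\<^bsub>G\<^esub> f'" for z f f'
    using that same F(2) by (intro fix_configs_rcos[OF H that(1)]) auto
  \<comment> \<open>Any element of \<open>A\<close> would do, but both copies must use the same
    one.\<close>
  let ?a = "x \<one>\<^bsub>G\<^esub>"
  obtain x' where x': "x' \<in> fix_configs G A (K i)"
    "\<And>g f. g \<in> carrier G \<Longrightarrow> f \<in> F \<Longrightarrow> K i #>\<^bsub>G\<^esub> g = K i #>\<^bsub>G\<^esub> f \<Longrightarrow> x' g = x f"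
    "\<And>g. g \<in> carrier G \<Longrightarrow> \<forall>f\<in>F. K i #>\<^bsub>G\<^esub> g \<noteq> K i #>\<^bsub>G\<^esub> f \<Longrightarrow> x' g = ?a"
    using fix_configs_extend[OF K[OF i] xA[OF one_closed] F(2) Fx per[OF x]] by blast
  obtain y' where y': "y' \<in> fix_configs G A (K i)"
    "\<And>g f. g \<in> carrier G \<Longrightarrow> f \<in> F \<Longrightarrow> K i #>\<^bsub>G\<^esub> g = K i #>\<^bsub>G\<^esub> f \<Longrightarrow> y' g = y f"
    "\<And>g. g \<in> carrier G \<Longrightarrow> \<forall>f\<in>F. K i #>\<^bsub>G\<^esub> g \<noteq> K i #>\<^bsub>G\<^esub> f \<Longrightarrow> y' g = ?a"
    using fix_configs_extend[OF K[OF i] xA[OF one_closed] F(2) Fy per[OF y]] by blast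
  have x'c: "x' \<in> configs G A" and y'c: "y' \<in> configs G A"
    using x'(1) y'(1) by (auto simp: fix_configs_def)
  \<comment> \<open>On a coset that meets \<open>F\<close> but not \<open>E\<close>,
    \<open>same\<close> shows that the copied point \<open>f\<close> is also outside the
    \<open>H\<close>-cosets of \<open>E\<close>; on a coset missing \<open>F\<close> both copies
    have the value \<open>?a\<close>.\<close>
  have off': "x' g = y' g" if g: "g \<in> carrier G" "\<forall>e\<in>E. K i #>\<^bsub>G\<^esub> g \<noteq> K i #>\<^bsub>G\<^esub> e" for g
  proof (cases "\<exists>f\<in>F. K i #>\<^bsub>G\<^esub> g = K i #>\<^bsub>G\<^esub> f")
    case True
    then obtain f where f: "f \<in> F" "K i #>\<^bsub>G\<^esub> g = K i #>\<^bsub>G\<^esub> f" by blast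
    then have "\<forall>e\<in>E. H #>\<^bsub>G\<^esub> f \<noteq> H #>\<^bsub>G\<^esub> e" using g(2) same[OF f(1)] by (auto simp: F_def)
    then have "x f = y f" using off f(1) F(2) by blast
    then show ?thesis using x'(2)[OF g(1) f] y'(2)[OF g(1) f] by simp
  next
    case False
    then show ?thesis using x'(3) y'(3) g(1) by auto
  qed
  have "\<tau> x' g = \<tau> y' g" if g: "g \<in> carrier G" for g
  \<comment> \<open>Either the window at \<open>g\<close> meets a coset of \<open>E\<close>, and it
    is a copy of a window of \<open>x\<close> and \<open>y\<close> at \<open>?h\<close>, or it
    avoids them all, and \<open>x'\<close> and \<open>y'\<close> coincide on it.\<close>
  proof (cases "\<exists>m\<in>M. \<exists>e\<in>E. K i #>\<^bsub>G\<^esub> (g \<otimes>\<^bsub>G\<^esub> m) = K i #>\<^bsub>G\<^esub> e")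
    case True
    then obtain m e where me: "m \<in> M" "e \<in> E" "K i #>\<^bsub>G\<^esub> (g \<otimes>\<^bsub>G\<^esub> m) = K i #>\<^bsub>G\<^esub> e" by blast
    have mG: "m \<in> carrier G" "e \<in> carrier G" using me M E by auto
    let ?h = "e \<otimes>\<^bsub>G\<^esub> inv\<^bsub>G\<^esub> m"
    have h: "?h \<in> carrier G" using mG by simp
    have gh: "K i #>\<^bsub>G\<^esub> g = K i #>\<^bsub>G\<^esub> ?h"
      using rcos_mult_cong[OF sub _ mG(2) inv_closed[OF mG(1)] me(3)] g mG by (simp add: m_assoc)
    have "x' (g \<otimes>\<^bsub>G\<^esub> m') = x (?h \<otimes>\<^bsub>G\<^esub> m') \<and> y' (g \<otimes>\<^bsub>G\<^esub> m') = y (?h \<otimes>\<^bsub>G\<^esub> m')"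
      if m': "m' \<in> M" for m'
    proof -
      have "m' \<in> carrier G" using m' M by auto
      moreover have "?h \<otimes>\<^bsub>G\<^esub> m' \<in> F"
        unfolding F_def using me m' by (intro UnI2 image_eqI[of _ _ "(e, m, m')"]) auto
      ultimately show ?thesis
        using x'(2) y'(2) rcos_mult_cong[OF sub g h _ gh] g by auto
    qed
    then have "\<tau> x' g = \<tau> x ?h" "\<tau> y' g = \<tau> y ?h"
      using local[OF x'c xc g h] local[OF y'c yc g h] by auto
    then show ?thesis using \<tau>xy by simp
  next
    case False
    then show ?thesis using M(2) g by (intro local[OF x'c y'c g g] off') auto
  qed
  moreover have "\<tau> x' \<in> configs G A" "\<tau> y' \<in> configs G A"
    using ca x'c y'c by (auto simp: cellular_automaton_def)
  ultimately have "\<tau> x' = \<tau> y'" unfolding configs_def by (intro PiE_ext)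
  then have eq: "x' = y'"
    using pre[OF i] x'(1) y'(1) E off' unfolding pre_injective_induced_ca_iff[OF K[OF i] ca]
    by blast
  \<comment> \<open>At points of \<open>E\<close>, which lie in \<open>F\<close>, the copies return
    the original values; periodicity under \<open>H\<close> then spreads the equality over the
    cosets of \<open>E\<close>.\<close>
  have on: "x e = y e" if "e \<in> E" for e
    using x'(2)[of e e] y'(2)[of e e] eq that E(2) by (auto simp: F_def)
  have "x g = y g" if g: "g \<in> carrier G" for g
  proof (cases "\<exists>e\<in>E. H #>\<^bsub>G\<^esub> g = H #>\<^bsub>G\<^esub> e")
    case True
    then obtain e where e: "e \<in> E" "H #>\<^bsub>G\<^esub> g = H #>\<^bsub>G\<^esub> e" by blast
    then have eG: "e \<in> carrier G" using E(2) by blast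
    show ?thesis
      using fix_configs_rcos[OF H x g eG e(2)] fix_configs_rcos[OF H y g eG e(2)] on[OF e(1)]
      by simp
  qed (use off g in blast)
  then show "x = y" using xc yc unfolding configs_def by (intro PiE_ext)
qed

text \<open>The index and the approximate preimage depend on the finite set of conditions
  considered, so finiteness of \<open>A\<close> is used to glue them by compactness.\<close>

lemma surjective_induced_ca_limit:
  fixes G :: "('g, 'b) monoid_scheme" and I :: "'i set"
  assumes G: "group G" and dir: "directed_set I r" and K: "\<And>i. i \<in> I \<Longrightarrow> K i \<lhd> G"
    and H: "H \<lhd> G" and lim: "limitin (normal_subgroup_topology G) K H (net_filter I r)"
    and ca: "cellular_automaton G A \<tau>" and A: "finite A"
    and surj: "\<And>i. i \<in> I \<Longrightarrow> surjective_ca (G Mod K i) A (induced_ca G A (K i) \<tau>)"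
  shows "surjective_ca (G Mod H) A (induced_ca G A H \<tau>)"
  unfolding surjective_induced_ca_iff[OF H ca]
proof
  fix y assume y: "y \<in> fix_configs G A H"
  interpret group G by fact
  have yc: "y \<in> configs G A" using y by (auto simp: fix_configs_def)
  have yA: "y g \<in> A" if "g \<in> carrier G" for g
    using yc that by (auto simp: configs_def PiE_iff)
  obtain M where M: "finite M" "M \<subseteq> carrier G"
    and local: "\<And>x y g h. x \<in> configs G A \<Longrightarrow> y \<in> configs G A \<Longrightarrow> g \<in> carrier G \<Longrightarrow>
      h \<in> carrier G \<Longrightarrow> (\<And>m. m \<in> M \<Longrightarrow> x (g \<otimes>\<^bsub>G\<^esub> m) = y (h \<otimes>\<^bsub>G\<^esub> m)) \<Longrightarrow> \<tau> x g = \<tau> y h"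
    using cellular_automaton_local[OF G ca] by blast
  \<comment> \<open>Over all pairs, the conditions say exactly that \<open>x\<close> is an
    \<open>H\<close>-periodic preimage of \<open>y\<close>.\<close>
  define P where "P = (\<lambda>(g, h) x. \<tau> x g = y g \<and> (H #>\<^bsub>G\<^esub> g = H #>\<^bsub>G\<^esub> h \<longrightarrow> x g = x h))"
  have "\<exists>x. x \<in> carrier G \<rightarrow>\<^sub>E A \<and> (\<forall>c\<in>carrier G \<times> carrier G. P c x)"
  proof (rule PiE_finitary_compactness[OF A, of "carrier G \<times> carrier G" "carrier G" P])
    fix c assume "c \<in> carrier G \<times> carrier G"
    then obtain g h where c: "c = (g, h)" and g: "g \<in> carrier G" and h: "h \<in> carrier G" by blast
    \<comment> \<open>The window \<open>g M\<close> determines the image at \<open>g\<close>; the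
      points \<open>g\<close> and \<open>h\<close> determine the periodicity condition.\<close>
    let ?S = "{g, h} \<union> (\<lambda>m. g \<otimes>\<^bsub>G\<^esub> m) ` M"
    have "P c x'" if "x \<in> carrier G \<rightarrow>\<^sub>E A" "x' \<in> carrier G \<rightarrow>\<^sub>E A" "\<forall>s\<in>?S. x s = x' s" "P c x" for x x'
    proof -
      have "\<tau> x g = \<tau> x' g" using that by (intro local[OF _ _ g g]) (auto simp: configs_def)
      then show ?thesis using that by (simp add: P_def c)
    qed
    moreover have "finite ?S" "?S \<subseteq> carrier G" using M g h by auto
    ultimately show "\<exists>S. finite S \<and> S \<subseteq> carrier G \<and> (\<forall>x\<in>carrier G \<rightarrow>\<^sub>E A.
        \<forall>x'\<in>carrier G \<rightarrow>\<^sub>E A. (\<forall>s\<in>S. x s = x' s) \<longrightarrow> P c x \<longrightarrow> P c x')"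
      by (intro exI[of _ ?S] conjI ballI impI)
  next
    fix D assume D: "finite D" "D \<subseteq> carrier G \<times> carrier G"
    \<comment> \<open>No windows are added here: \<tau> maps \<open>x\<close> exactly to
      \<open>y'\<close>, so only the values of \<open>y'\<close> and the coset relation on the
      points of \<open>D\<close> are compared.\<close>
    define F where "F = fst ` D \<union> snd ` D"
    have F: "finite F" "F \<subseteq> carrier G" using D by (auto simp: F_def)
    obtain i where i: "i \<in> I" and same: "\<And>f f'. f \<in> F \<Longrightarrow> f' \<in> F \<Longrightarrow>
        K i #>\<^bsub>G\<^esub> f = K i #>\<^bsub>G\<^esub> f' \<longleftrightarrow> H #>\<^bsub>G\<^esub> f = H #>\<^bsub>G\<^esub> f'"
      using limitin_same_cosets[OF G dir K H lim F] by blast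
    have Fy: "y \<in> F \<rightarrow> A" using yA F(2) by auto
    have per: "y f = y f'" if "f \<in> F" "f' \<in> F" "K i #>\<^bsub>G\<^esub> f = K i #>\<^bsub>G\<^esub> f'" for f f'
      using that same F(2) by (intro fix_configs_rcos[OF H y]) auto
    obtain y' where y': "y' \<in> fix_configs G A (K i)"
      "\<And>g f. g \<in> carrier G \<Longrightarrow> f \<in> F \<Longrightarrow> K i #>\<^bsub>G\<^esub> g = K i #>\<^bsub>G\<^esub> f \<Longrightarrow> y' g = y f"
      "\<And>g. g \<in> carrier G \<Longrightarrow> \<forall>f\<in>F. K i #>\<^bsub>G\<^esub> g \<noteq> K i #>\<^bsub>G\<^esub> f \<Longrightarrow> y' g = y \<one>\<^bsub>G\<^esub>"
      using fix_configs_extend[OF K[OF i] yA[OF one_closed] F(2) Fy per] by blast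
    obtain x where x: "x \<in> fix_configs G A (K i)" "\<tau> x = y'"
      using surj[OF i] y'(1) unfolding surjective_induced_ca_iff[OF K[OF i] ca] by blast
    have "P c x" if c: "c \<in> D" for c
    proof -
      obtain g h where gh: "c = (g, h)" by fastforce
      then have ghF: "g \<in> F" "h \<in> F" using c by (force simp: F_def)+
      then have ghG: "g \<in> carrier G" "h \<in> carrier G" using F(2) by auto
      \<comment> \<open>\<open>same\<close> turns equal \<open>H\<close>-cosets into equal
        \<open>K i\<close>-cosets, on which \<open>x\<close> is constant.\<close>
      have "x g = x h" if "H #>\<^bsub>G\<^esub> g = H #>\<^bsub>G\<^esub> h"
        using fix_configs_rcos[OF K[OF i] x(1) ghG] same[OF ghF] that by blast
      moreover have "\<tau> x g = y g" using y'(2)[OF ghG(1) ghF(1)] x(2) by simp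
      ultimately show ?thesis by (simp add: P_def gh)
    qed
    moreover have "x \<in> carrier G \<rightarrow>\<^sub>E A" using x(1) by (simp add: fix_configs_def configs_def)
    ultimately show "\<exists>x\<in>carrier G \<rightarrow>\<^sub>E A. \<forall>c\<in>D. P c x" by blast
  qed blast
  then obtain x where x: "x \<in> configs G A"
    and Px: "\<And>g h. g \<in> carrier G \<Longrightarrow> h \<in> carrier G \<Longrightarrow> P (g, h) x"
    by (auto simp: configs_def)
  have "x \<in> fix_configs G A H"
    using x Px unfolding fix_configs_iff[OF H] P_def prod.case by blast
  moreover have "\<tau> x = y"
  proof -
    have "\<tau> x \<in> configs G A" using ca x by (auto simp: cellular_automaton_def)
    moreover have "\<tau> x g = y g" if "g \<in> carrier G" for g using Px[OF that that] by (simp add: P_def)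
    ultimately show ?thesis using yc unfolding configs_def by (intro PiE_ext)
  qed
  ultimately show "y \<in> \<tau> ` fix_configs G A H" by blast
qed

theorem lemma7p1:
  fixes \<Gamma> :: "('g, 'b) monoid_scheme"
    and I :: "'i set" and r :: "'i \<Rightarrow> 'i \<Rightarrow> bool"
    and Hi :: "'i \<Rightarrow> 'g set" and H :: "'g set"
    and A :: "'a set" and \<tau> :: "('g \<Rightarrow> 'a) \<Rightarrow> 'g \<Rightarrow> 'a"
  assumes "group \<Gamma>"
    and "directed_set I r"
    and "\<And>i. i \<in> I \<Longrightarrow> Hi i \<lhd> \<Gamma>"
    and "H \<lhd> \<Gamma>"
    and "limitin (normal_subgroup_topology \<Gamma>) Hi H (net_filter I r)"
    and "cellular_automaton \<Gamma> A \<tau>"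
  shows "((\<forall>i\<in>I. pre_injective (\<Gamma> Mod Hi i) A (induced_ca \<Gamma> A (Hi i) \<tau>)) \<longrightarrow>
           pre_injective (\<Gamma> Mod H) A (induced_ca \<Gamma> A H \<tau>)) \<and>
         (finite A \<longrightarrow>
           (\<forall>i\<in>I. surjective_ca (\<Gamma> Mod Hi i) A (induced_ca \<Gamma> A (Hi i) \<tau>)) \<longrightarrow>
           surjective_ca (\<Gamma> Mod H) A (induced_ca \<Gamma> A H \<tau>))"
  using pre_injective_induced_ca_limit[OF assms] surjective_induced_ca_limit[OF assms] by blast

end
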